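(* Let $d\ge1$, $f\in\mathbb{Z}[\mathbb{Z}^d]$ and $N\ge1$. Then the contracted ideal $\langle f\rangle\cap\mathbb{Z}[N\mathbb{Z}^d]$ is a principal ideal in $\mathbb{Z}[N\mathbb{Z}^d]$.
   Context: $\mathbb{Z}[\mathbb{Z}^d]$ is the integral group ring of $\mathbb{Z}^d$, identified with the Laurent polynomial ring $\mathbb{Z}[x_1^{\pm1},\dots,x_d^{\pm1}]$. $\mathbb{Z}[N\mathbb{Z}^d]$ is the subring $\mathbb{Z}[x_1^{\pm N},\dots,x_d^{\pm N}]$ of Laurent polynomials supported on $N\mathbb{Z}^d$. $\langle f\rangle$ is the principal ideal of $\mathbb{Z}[\mathbb{Z}^d]$ generated by $f$. *)

theory Defs
  imports "HOL-Analysis.Analysis" "HOL-Algebra.Algebra" "HOL-Algebra.Algebraic_Closure_Type" "HOL-Library.Poly_Mapping"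
begin

text \<open>
  The integral group ring of \<open>\<int>\<^sup>d\<close>, with \<open>d = CARD('d)\<close>, is the type of finitely supported
  functions \<open>(int ^ 'd) \<Rightarrow>\<^sub>0 int\<close>, whose type-class multiplication is convolution: the exponent
  vector \<open>v\<close> stands for the monomial \<open>x\<^sub>1\<^bsup>v\<^sub>1\<^esup> \<cdots> x\<^sub>d\<^bsup>v\<^sub>d\<^esup>\<close>. As \<open>'d\<close> is nonempty, \<open>d \<ge> 1\<close> is automatic.
\<close>

abbreviation laurent_ring :: "((int ^ 'd) \<Rightarrow>\<^sub>0 int) ring"
  where "laurent_ring \<equiv> ring_of_type_algebra"

definition multiples_lattice :: "nat \<Rightarrow> (int ^ 'd) set"
  where "multiples_lattice N = range (\<lambda>v. int N *s v)"

definition laurent_subring :: "nat \<Rightarrow> ((int ^ 'd) \<Rightarrow>\<^sub>0 int) ring"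
  where "laurent_subring N =
    laurent_ring\<lparr>carrier := {g. Poly_Mapping.keys g \<subseteq> multiples_lattice N}\<rparr>"

lemma cring_laurent_ring: "cring (laurent_ring :: ((int ^ 'd) \<Rightarrow>\<^sub>0 int) ring)"
  by (rule cring_from_type_algebra)

lemma multiples_lattice_zero: "0 \<in> multiples_lattice N"
  unfolding multiples_lattice_def by (rule range_eqI[of _ _ 0]) simp

lemma multiples_lattice_add:
  "v \<in> multiples_lattice N \<Longrightarrow> w \<in> multiples_lattice N \<Longrightarrow> v + w \<in> multiples_lattice N"
  unfolding multiples_lattice_def by (auto simp flip: vector_add_ldistrib)

lemma subcring_laurent_subring:
  "subcring (carrier (laurent_subring N)) (laurent_ring :: ((int ^ 'd) \<Rightarrow>\<^sub>0 int) ring)"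
proof -
  interpret L: cring "laurent_ring :: ((int ^ 'd) \<Rightarrow>\<^sub>0 int) ring"
    by (rule cring_laurent_ring)
  have inv: "\<ominus>\<^bsub>laurent_ring\<^esub> h = - h" for h :: "(int ^ 'd) \<Rightarrow>\<^sub>0 int"
    by (rule L.minus_equality) (simp_all add: ring_of_type_algebra_def)
  have mult: "Poly_Mapping.keys (g * h) \<subseteq> multiples_lattice N"
    if "Poly_Mapping.keys g \<subseteq> multiples_lattice N" "Poly_Mapping.keys h \<subseteq> multiples_lattice N"
    for g h :: "(int ^ 'd) \<Rightarrow>\<^sub>0 int"
    using keys_mult[of g h] that multiples_lattice_add by blast
  have add: "Poly_Mapping.keys (g + h) \<subseteq> multiples_lattice N"
    if "Poly_Mapping.keys g \<subseteq> multiples_lattice N" "Poly_Mapping.keys h \<subseteq> multiples_lattice N"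
    for g h :: "(int ^ 'd) \<Rightarrow>\<^sub>0 int"
    using Poly_Mapping.keys_add[of g h] that by blast
  show ?thesis
  proof (rule L.subcringI'[OF L.subringI])
    fix g h :: "(int ^ 'd) \<Rightarrow>\<^sub>0 int"
    assume "g \<in> carrier (laurent_subring N)" "h \<in> carrier (laurent_subring N)"
    then show "g \<otimes>\<^bsub>laurent_ring\<^esub> h \<in> carrier (laurent_subring N)"
      and "g \<oplus>\<^bsub>laurent_ring\<^esub> h \<in> carrier (laurent_subring N)"
      using mult add by (auto simp: laurent_subring_def ring_of_type_algebra_def)
  next
    fix h :: "(int ^ 'd) \<Rightarrow>\<^sub>0 int"
    assume "h \<in> carrier (laurent_subring N)"
    then show "\<ominus>\<^bsub>laurent_ring\<^esub> h \<in> carrier (laurent_subring N)"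
      by (simp add: inv laurent_subring_def)
  qed (auto simp: laurent_subring_def ring_of_type_algebra_def multiples_lattice_zero)
qed

lemma cring_laurent_subring: "cring (laurent_subring N :: ((int ^ 'd) \<Rightarrow>\<^sub>0 int) ring)"
proof -
  interpret L: cring "laurent_ring :: ((int ^ 'd) \<Rightarrow>\<^sub>0 int) ring"
    by (rule cring_laurent_ring)
  let ?S = "carrier (laurent_subring N) :: ((int ^ 'd) \<Rightarrow>\<^sub>0 int) set"
  have "subcring ?S laurent_ring"
    by (rule subcring_laurent_subring)
  then have "cring (laurent_ring\<lparr>carrier := ?S\<rparr>)"
    using L.subcring_iff[of ?S] by (simp add: ring_of_type_algebra_def)
  then show ?thesis
    by (simp add: laurent_subring_def)
qed

end

theory Submission
  imports Defs
begin

text \<open>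
  Write \<open>R\<close> for the Laurent polynomial ring and \<open>S\<close> for the subring supported on \<open>N\<int>\<^sup>d\<close>. If
  \<open>\<langle>f\<rangle> \<inter> S = 0\<close> there is nothing to do, so let \<open>w = f h \<noteq> 0\<close> lie in \<open>S\<close>. Since \<open>R\<close> is a domain,
  \<open>f\<close> divides \<open>g\<close> exactly if \<open>w\<close> divides \<open>g h\<close>. Now \<open>R\<close> is free over \<open>S\<close>, with one monomial from
  each coset of \<open>N\<int>\<^sup>d\<close> as basis. If \<open>u\<^sub>r\<close> are the coordinates of \<open>h\<close> in this basis and \<open>g \<in> S\<close>,
  then \<open>g h\<close> has the coordinates \<open>g u\<^sub>r\<close>. Hence \<open>\<langle>f\<rangle> \<inter> S\<close> is the finite intersection of the colon
  ideals \<open>(w) : (u\<^sub>r)\<close> of \<open>S\<close> (\<open>coset_decomposition\<close>, \<open>part_on_mult\<close>, \<open>contraction_generator\<close>).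

  In a GCD domain \<open>(w) : (u)\<close> is generated by \<open>w / gcd w u\<close>, and finite intersections of such
  ideals are again principal (\<open>principal_colon_finite\<close>). It remains to see that \<open>S\<close> is a GCD domain,
  which is shown by adjoining to \<open>\<int>\<close> one invertible variable at a time
  (\<open>gcd_subring_coordinate_lattice\<close>). The core is that \<open>A[x]\<close> is a GCD domain if \<open>A\<close> is one
  (\<open>gcd_subring_polys_over\<close>): contents reduce the claim to primitive polynomials, Gauss's lemma lets
  one multiply by constants freely when testing divisibility by a primitive polynomial, and so a
  Euclidean algorithm by pseudo-division determines the colon ideals. Gauss's lemma is obtained
  without prime elements, as McCoy's theorem on zero divisors in \<open>(A/a)[x]\<close>.

  As the number of variables is the cardinality of a type, the induction on it takes place among the
  subrings of the one ring \<open>R\<close>. This is why rings are sets of elements of an ambient commutative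
  ring, and divisibility is relative to such a set.
\<close>

(* Polynomial vocabulary refers to the type 'a poly throughout. *)
hide_const (open) up_ring.coeff up_ring.monom module.smult Polynomials.degree Polynomials.lead_coeff

section \<open>Subrings in which colon ideals are principal\<close>

definition dvd_in :: "'a::comm_ring_1 set \<Rightarrow> 'a \<Rightarrow> 'a \<Rightarrow> bool"
  where "dvd_in A a b \<longleftrightarrow> (\<exists>t\<in>A. b = a * t)"

definition principal_colon :: "'a::comm_ring_1 set \<Rightarrow> 'a \<Rightarrow> 'a \<Rightarrow> bool"
  where "principal_colon A a b \<longleftrightarrow> (\<exists>c\<in>A. \<forall>g\<in>A. dvd_in A a (g * b) \<longleftrightarrow> dvd_in A c g)"

locale integral_subring =
  fixes A :: "'a::comm_ring_1 set"
  assumes one_mem: "1 \<in> A"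
    and diff_mem: "a \<in> A \<Longrightarrow> b \<in> A \<Longrightarrow> a - b \<in> A"
    and mult_mem: "a \<in> A \<Longrightarrow> b \<in> A \<Longrightarrow> a * b \<in> A"
    and no_zero_divisors: "a \<in> A \<Longrightarrow> b \<in> A \<Longrightarrow> a * b = 0 \<Longrightarrow> a = 0 \<or> b = 0"
begin

lemma zero_mem: "0 \<in> A"
  using diff_mem[OF one_mem one_mem] by simp

lemma uminus_mem: "a \<in> A \<Longrightarrow> - a \<in> A"
  using diff_mem[OF zero_mem] by fastforce

lemma add_mem: "a \<in> A \<Longrightarrow> b \<in> A \<Longrightarrow> a + b \<in> A"
  using diff_mem[of a "- b"] uminus_mem by simp

lemma sum_mem: "(\<And>i. i \<in> I \<Longrightarrow> h i \<in> A) \<Longrightarrow> sum h I \<in> A"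
  by (induction I rule: infinite_finite_induct) (auto intro: add_mem zero_mem)

lemma power_mem: "a \<in> A \<Longrightarrow> a ^ n \<in> A"
  by (induction n) (auto intro: one_mem mult_mem)

lemma mult_left_cancel_mem:
  "c \<in> A \<Longrightarrow> a \<in> A \<Longrightarrow> b \<in> A \<Longrightarrow> c \<noteq> 0 \<Longrightarrow> c * a = c * b \<longleftrightarrow> a = b"
  using no_zero_divisors[of c "a - b"] diff_mem[of a b] by (auto simp: algebra_simps)

lemma dvd_in_mult_cancel_left:
  assumes "c \<in> A" "a \<in> A" "b \<in> A" "c \<noteq> 0"
  shows "dvd_in A (c * a) (c * b) \<longleftrightarrow> dvd_in A a b"
proof -
  have "c * b = c * a * t \<longleftrightarrow> b = a * t" if "t \<in> A" for t
    using mult_left_cancel_mem[of c b "a * t"] assms that mult_mem by (simp add: mult.assoc)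
  then show ?thesis by (auto simp: dvd_in_def)
qed

lemma dvd_in_refl: "dvd_in A a a"
  using one_mem by (auto simp: dvd_in_def intro!: bexI[of _ 1])

lemma dvd_in_zero: "dvd_in A a 0"
  using zero_mem by (auto simp: dvd_in_def intro!: bexI[of _ 0])

lemma dvd_in_mult: "dvd_in A a b \<Longrightarrow> c \<in> A \<Longrightarrow> dvd_in A a (b * c)"
  using mult_mem by (auto simp: dvd_in_def mult.assoc)

lemma dvd_in_mult2: "dvd_in A a b \<Longrightarrow> c \<in> A \<Longrightarrow> dvd_in A a (c * b)"
  using dvd_in_mult by (simp add: mult.commute)

lemma dvd_in_triv: "c \<in> A \<Longrightarrow> dvd_in A a (a * c)"
  by (auto simp: dvd_in_def)

lemma dvd_in_add: "dvd_in A a b \<Longrightarrow> dvd_in A a c \<Longrightarrow> dvd_in A a (b + c)"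
  unfolding dvd_in_def by (metis add_mem distrib_left)

lemma dvd_in_diff: "dvd_in A a b \<Longrightarrow> dvd_in A a c \<Longrightarrow> dvd_in A a (b - c)"
  unfolding dvd_in_def by (metis diff_mem right_diff_distrib)

lemma dvd_in_sum: "(\<And>i. i \<in> I \<Longrightarrow> dvd_in A a (h i)) \<Longrightarrow> dvd_in A a (sum h I)"
  by (induction I rule: infinite_finite_induct) (auto intro: dvd_in_add dvd_in_zero)

lemma dvd_in_one_mult: "dvd_in A c 1 \<Longrightarrow> g \<in> A \<Longrightarrow> dvd_in A c g"
  using dvd_in_mult2[of c 1 g] by simp

lemma principal_colon_zero:
  assumes "a \<in> A" "b \<in> A" "a = 0 \<or> b = 0"
  shows "principal_colon A a b"
proof (cases "b = 0")
  case True
  then have "\<forall>g\<in>A. dvd_in A a (g * b) \<longleftrightarrow> dvd_in A 1 g"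
    by (auto simp: dvd_in_zero intro: dvd_in_one_mult dvd_in_refl)
  then show ?thesis using one_mem by (auto simp: principal_colon_def)
next
  case False
  then have "\<forall>g\<in>A. dvd_in A a (g * b) \<longleftrightarrow> dvd_in A 0 g"
    using assms no_zero_divisors zero_mem by (auto simp: dvd_in_def)
  then show ?thesis using zero_mem by (auto simp: principal_colon_def)
qed

text \<open>
  For nonzero \<open>a\<close> and \<open>b\<close>, both \<open>(a) : (b)\<close> and \<open>(b) : (a)\<close> are the ideal \<open>(a) \<inter> (b)\<close> of common multiples up to a
  factor: \<open>g \<mapsto> g b\<close> and \<open>s \<mapsto> s a\<close> map them onto it. So a generator \<open>c\<close> of the second gives the
  generator \<open>c a / b\<close> of the first.
\<close>

lemma principal_colon_swap:
  assumes ab: "a \<in> A" "b \<in> A" and col: "principal_colon A b a"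
  shows "principal_colon A a b"
proof (cases "a = 0 \<or> b = 0")
  case True
  then show ?thesis using principal_colon_zero ab by blast
next
  case False
  obtain c where c: "c \<in> A" "\<And>g. g \<in> A \<Longrightarrow> dvd_in A b (g * a) \<longleftrightarrow> dvd_in A c g"
    using col by (auto simp: principal_colon_def)
  obtain e where e: "e \<in> A" "c * a = b * e"
    using c(2)[OF c(1)] dvd_in_refl[of c] unfolding dvd_in_def by blast
  have "dvd_in A a (g * b) \<longleftrightarrow> dvd_in A e g" if g: "g \<in> A" for g
  proof
    assume "dvd_in A a (g * b)"
    then obtain s where s: "s \<in> A" "g * b = a * s" by (auto simp: dvd_in_def)
    then have "dvd_in A b (s * a)"
      using g by (auto simp: dvd_in_def ac_simps intro!: bexI[of _ g])
    then obtain t where t: "t \<in> A" "s = c * t"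
      using c(2)[OF s(1)] by (auto simp: dvd_in_def)
    have "b * g = (c * a) * t"
      using s t by (simp add: ac_simps)
    also have "\<dots> = b * (e * t)"
      using e by (simp add: ac_simps)
    finally have "g = e * t"
      using mult_left_cancel_mem ab g e t mult_mem False by blast
    then show "dvd_in A e g" using t by (auto simp: dvd_in_def)
  next
    assume "dvd_in A e g"
    then obtain t where t: "t \<in> A" "g = e * t" by (auto simp: dvd_in_def)
    have "g * b = (b * e) * t"
      using t by (simp add: ac_simps)
    also have "\<dots> = a * (c * t)"
      by (simp add: ac_simps flip: e(2))
    finally show "dvd_in A a (g * b)" using c t mult_mem by (auto simp: dvd_in_def)
  qed
  then show ?thesis using e by (auto simp: principal_colon_def)
qed

end

text \<open>
  For a domain, principality of all colon ideals is equivalent to the existence of greatest common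
  divisors: \<open>(a) : (b)\<close> is generated by \<open>a / gcd a b\<close>. The colon form speaks of divisibility alone and
  is the one that the final argument consumes.
\<close>

locale gcd_subring = integral_subring +
  assumes colon: "a \<in> A \<Longrightarrow> b \<in> A \<Longrightarrow> principal_colon A a b"
begin

text \<open>
  If \<open>c\<close> generates the intersection for \<open>U\<close>, its elements are \<open>g = c t\<close>, and the condition for one
  further \<open>u\<close> becomes membership of \<open>t\<close> in the colon ideal \<open>(a) : (c u)\<close>.
\<close>

lemma principal_colon_finite:
  assumes "finite U" "U \<subseteq> A" "a \<in> A"
  shows "\<exists>c\<in>A. \<forall>g\<in>A. (\<forall>u\<in>U. dvd_in A a (g * u)) \<longleftrightarrow> dvd_in A c g"
  using assms
proof (induction U)
  case empty
  show ?case using one_mem dvd_in_one_mult dvd_in_refl by auto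
next
  case (insert u U)
  then obtain c where c: "c \<in> A"
    "\<And>g. g \<in> A \<Longrightarrow> (\<forall>u\<in>U. dvd_in A a (g * u)) \<longleftrightarrow> dvd_in A c g" by auto
  obtain e where e: "e \<in> A" "\<And>g. g \<in> A \<Longrightarrow> dvd_in A a (g * (c * u)) \<longleftrightarrow> dvd_in A e g"
    using colon[of a "c * u"] c insert.prems mult_mem by (auto simp: principal_colon_def)
  have "(\<forall>v\<in>insert u U. dvd_in A a (g * v)) \<longleftrightarrow> dvd_in A (c * e) g" if g: "g \<in> A" for g
  proof
    assume L: "\<forall>v\<in>insert u U. dvd_in A a (g * v)"
    then obtain t where t: "t \<in> A" "g = c * t" using c(2)[OF g] by (auto simp: dvd_in_def)
    then have "dvd_in A a (t * (c * u))" using L by (simp add: ac_simps)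
    then have "dvd_in A e t" using e(2)[OF t(1)] by blast
    then show "dvd_in A (c * e) g"
      using t by (auto simp: dvd_in_def mult.assoc)
  next
    assume "dvd_in A (c * e) g"
    then obtain t where t: "t \<in> A" "g = c * e * t" by (auto simp: dvd_in_def)
    have "dvd_in A a ((e * t) * (c * u))"
      using e t mult_mem dvd_in_triv by blast
    then have "dvd_in A a (g * u)" using t by (simp add: ac_simps)
    moreover have "dvd_in A c g" using t e mult_mem by (auto simp: dvd_in_def mult.assoc)
    ultimately show "\<forall>v\<in>insert u U. dvd_in A a (g * v)" using c(2)[OF g] by auto
  qed
  then show ?case using c e mult_mem by (intro bexI[of _ "c * e"]) auto
qed

end

section \<open>Polynomials over a GCD domain\<close>

definition polys_over :: "'a::comm_ring_1 set \<Rightarrow> 'a poly set"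
  where "polys_over A = {p. \<forall>i. coeff p i \<in> A}"

lemma coeff_mem: "p \<in> polys_over A \<Longrightarrow> coeff p i \<in> A"
  by (simp add: polys_over_def)

lemma integral_subring_polys_over:
  assumes "integral_subring A" shows "integral_subring (polys_over A)"
proof -
  interpret integral_subring A by fact
  show ?thesis
  proof
    show "1 \<in> polys_over A" using one_mem zero_mem by (auto simp: polys_over_def coeff_1)
    fix p q :: "'a poly" assume p: "p \<in> polys_over A" and q: "q \<in> polys_over A"
    show "p - q \<in> polys_over A" using p q diff_mem by (auto simp: polys_over_def)
    show "p * q \<in> polys_over A"
      using p q by (auto simp: polys_over_def coeff_mult intro!: sum_mem mult_mem)
    assume "p * q = 0"
    then have "lead_coeff p * lead_coeff q = 0"
      using coeff_mult_degree_sum[of p q] by simp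
    then show "p = 0 \<or> q = 0"
      using no_zero_divisors[of "lead_coeff p" "lead_coeff q"] coeff_mem p q by auto
  qed
qed

context integral_subring
begin

interpretation P: integral_subring "polys_over A"
  by (rule integral_subring_polys_over) unfold_locales

lemma monom_mem: "a \<in> A \<Longrightarrow> monom a n \<in> polys_over A"
  using zero_mem by (auto simp: polys_over_def)

lemma smult_mem: "a \<in> A \<Longrightarrow> p \<in> polys_over A \<Longrightarrow> smult a p \<in> polys_over A"
  using mult_mem by (auto simp: polys_over_def)

definition const_dvd :: "'a \<Rightarrow> 'a poly \<Rightarrow> bool"
  where "const_dvd a p \<longleftrightarrow> (\<forall>i. dvd_in A a (coeff p i))"

definition primitive :: "'a poly \<Rightarrow> bool"
  where "primitive p \<longleftrightarrow> (\<forall>a\<in>A. const_dvd a p \<longrightarrow> dvd_in A a 1)"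

lemma const_dvd_iff: "const_dvd a p \<longleftrightarrow> (\<exists>q\<in>polys_over A. p = smult a q)"
proof
  assume "const_dvd a p"
  then obtain t where t: "\<And>i. t i \<in> A" "\<And>i. coeff p i = a * t i"
    unfolding const_dvd_def dvd_in_def by metis
  have "p = (\<Sum>i\<le>degree p. monom (coeff p i) i)" by (simp add: poly_as_sum_of_monoms)
  also have "\<dots> = (\<Sum>i\<le>degree p. smult a (monom (t i) i))" by (simp add: t smult_monom)
  also have "\<dots> = smult a (\<Sum>i\<le>degree p. monom (t i) i)"
    by (intro poly_eqI) (simp only: coeff_sum coeff_smult sum_distrib_left)
  finally show "\<exists>q\<in>polys_over A. p = smult a q"
    using t monom_mem by (intro bexI[of _ "\<Sum>i\<le>degree p. monom (t i) i"] P.sum_mem) auto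
qed (auto simp: const_dvd_def intro!: dvd_in_triv coeff_mem)

lemma const_dvd_add: "const_dvd a p \<Longrightarrow> const_dvd a q \<Longrightarrow> const_dvd a (p + q)"
  by (auto simp: const_dvd_def dvd_in_add)

lemma const_dvd_diff: "const_dvd a p \<Longrightarrow> const_dvd a q \<Longrightarrow> const_dvd a (p - q)"
  by (auto simp: const_dvd_def dvd_in_diff)

lemma const_dvd_mult: "p \<in> polys_over A \<Longrightarrow> const_dvd a q \<Longrightarrow> const_dvd a (p * q)"
  by (auto simp: const_dvd_def coeff_mult polys_over_def intro!: dvd_in_sum dvd_in_mult2)

lemma const_dvd_smult: "b \<in> A \<Longrightarrow> const_dvd a q \<Longrightarrow> const_dvd a (smult b q)"
  by (auto simp: const_dvd_def intro!: dvd_in_mult2)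

end

context gcd_subring
begin

interpretation P: integral_subring "polys_over A"
  by (rule integral_subring_polys_over) unfold_locales

text \<open>
  The relation \<open>gcd (s p\<^sub>i) = s gcd (p\<^sub>i)\<close> in disguise: the generator of \<open>(a) : (s)\<close> divides every
  coefficient of \<open>p\<close>, hence is a unit. In terms of \<open>A/a\<close>, no nonzero constant annihilates \<open>p\<close>.
\<close>

lemma dvd_in_if_const_dvd_smult_primitive:
  assumes p: "p \<in> polys_over A" "primitive p" and as: "a \<in> A" "s \<in> A"
    and "const_dvd a (smult s p)"
  shows "dvd_in A a s"
proof -
  obtain c where c: "c \<in> A" "\<And>g. g \<in> A \<Longrightarrow> dvd_in A a (g * s) \<longleftrightarrow> dvd_in A c g"
    using colon[OF as] by (auto simp: principal_colon_def)
  have "const_dvd c p"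
    using assms(5) p(1) by (auto simp: const_dvd_def polys_over_def mult.commute simp flip: c(2))
  then have "dvd_in A c 1" using p c(1) by (auto simp: primitive_def)
  then show ?thesis using c(2)[of 1] one_mem by auto
qed

text \<open>
  McCoy's theorem for \<open>(A/a)[x]\<close>: a polynomial that no nonzero constant annihilates is not a zero
  divisor. The bound \<open>m\<close> on the length of \<open>u\<close> is the induction parameter. Working down from the top
  coefficient of \<open>p\<close>, suppose \<open>a\<close> divides \<open>p\<^sub>k u\<close> for all \<open>k > i\<close>. The coefficient of \<open>p u\<close> in
  degree \<open>i + m\<close> shows that \<open>a\<close> divides \<open>p\<^sub>i u\<^sub>m\<close>, so modulo \<open>a\<close> the polynomial \<open>p\<^sub>i u\<close> is shorter than
  \<open>u\<close> and still annihilated by \<open>p\<close>; by induction \<open>a\<close> divides it. Thus \<open>a\<close> divides \<open>p\<^sub>i u\<close> for all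
  \<open>i\<close>, which says that each coefficient of \<open>u\<close> annihilates \<open>p\<close> modulo \<open>a\<close>.
\<close>

lemma mccoy:
  assumes p: "p \<in> polys_over A" "primitive p" and a: "a \<in> A"
  shows "u \<in> polys_over A \<Longrightarrow> \<forall>i\<ge>m. coeff u i = 0 \<Longrightarrow> const_dvd a (p * u) \<Longrightarrow> const_dvd a u"
proof (induction m arbitrary: u)
  case 0
  then show ?case by (auto simp: const_dvd_def dvd_in_zero)
next
  case (Suc m)
  have cdiv: "const_dvd a (smult (coeff p i) u)" for i
  proof (induction "degree p - i" arbitrary: i rule: less_induct)
    case less
    show ?case
    proof (cases "i \<le> degree p")
      case False
      then show ?thesis by (simp add: coeff_eq_0 const_dvd_def dvd_in_zero)
    next
      case True
      let ?c = "coeff p i * coeff u m"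
      \<comment> \<open>The terms with \<open>k < i\<close> vanish by the bound on \<open>u\<close>, those with \<open>k > i\<close> are divisible by \<open>a\<close>.\<close>
      have "coeff (p * u) (i + m)
        = ?c + (\<Sum>k\<in>{..i + m} - {i}. coeff p k * coeff u (i + m - k))"
        by (subst coeff_mult, subst sum.remove[of _ i]) auto
      moreover have "dvd_in A a (coeff p k * coeff u (i + m - k))" if "k \<noteq> i" for k
      proof (cases "k < i \<or> k > degree p")
        case True
        then show ?thesis using Suc.prems(2) by (auto simp: dvd_in_zero coeff_eq_0)
      next
        case False
        then have "degree p - k < degree p - i" using that by auto
        from less[OF this] show ?thesis by (auto simp: const_dvd_def)
      qed
      then have "dvd_in A a (\<Sum>k\<in>{..i + m} - {i}. coeff p k * coeff u (i + m - k))"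
        by (intro dvd_in_sum) auto
      moreover have "dvd_in A a (coeff (p * u) (i + m))"
        using Suc.prems(3) by (auto simp: const_dvd_def)
      ultimately have c: "dvd_in A a ?c"
        using dvd_in_diff by fastforce
      then have top: "const_dvd a (monom ?c m)"
        by (auto simp: const_dvd_def dvd_in_zero)
      define u' where "u' = smult (coeff p i) u - monom ?c m"
      have "u' \<in> polys_over A"
        unfolding u'_def using p(1) Suc.prems(1)
        by (intro P.diff_mem smult_mem monom_mem mult_mem coeff_mem) auto
      moreover have "\<forall>j\<ge>m. coeff u' j = 0"
        using Suc.prems(2) by (auto simp: u'_def)
      moreover have "p * u' = smult (coeff p i) (p * u) - p * monom ?c m"
        by (simp add: u'_def algebra_simps)
      then have "const_dvd a (p * u')"
        using Suc.prems(3) top p(1) const_dvd_diff const_dvd_smult const_dvd_mult coeff_mem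
        by metis
      ultimately have "const_dvd a u'" by (rule Suc.IH)
      then have "const_dvd a (u' + monom ?c m)" using top const_dvd_add by blast
      then show ?thesis by (simp add: u'_def)
    qed
  qed
  show ?case
    unfolding const_dvd_def
  proof
    fix j
    have "const_dvd a (smult (coeff u j) p)"
      using cdiv by (auto simp: const_dvd_def mult.commute)
    then show "dvd_in A a (coeff u j)"
      using dvd_in_if_const_dvd_smult_primitive p a Suc.prems(1) coeff_mem by blast
  qed
qed

lemma gauss_lemma:
  assumes p: "p \<in> polys_over A" "primitive p" and a: "a \<in> A"
    and u: "u \<in> polys_over A" "const_dvd a (p * u)"
  shows "const_dvd a u"
  using mccoy[OF p a u(1) _ u(2), of "Suc (degree u)"] coeff_eq_0[of u] by auto

lemma primitive_dvd_smult_iff: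
  assumes p: "p \<in> polys_over A" "primitive p" and a: "a \<in> A" "a \<noteq> 0" and q: "q \<in> polys_over A"
  shows "dvd_in (polys_over A) p (smult a q) \<longleftrightarrow> dvd_in (polys_over A) p q"
proof
  assume "dvd_in (polys_over A) p (smult a q)"
  then obtain u where u: "u \<in> polys_over A" "smult a q = p * u" by (auto simp: dvd_in_def)
  have "const_dvd a (p * u)" using const_dvd_iff q u(2) by metis
  then obtain v where v: "v \<in> polys_over A" "u = smult a v"
    using gauss_lemma[OF p a(1) u(1)] const_dvd_iff by blast
  have "[:a:] * q = [:a:] * (p * v)" using u v by simp
  moreover have "[:a:] \<in> polys_over A" using monom_mem[OF a(1), of 0] by (simp add: monom_0)
  ultimately have "q = p * v"
    using P.mult_left_cancel_mem[of "[:a:]" q "p * v"] P.mult_mem p v q a by simp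
  then show "dvd_in (polys_over A) p q" using v by (auto simp: dvd_in_def)
next
  assume "dvd_in (polys_over A) p q"
  then show "dvd_in (polys_over A) p (smult a q)"
    unfolding dvd_in_def using smult_mem[OF a(1)] by (metis mult_smult_right)
qed

text \<open>
  The content is extracted from a finite colon ideal. With \<open>w\<close> the leading coefficient of \<open>p\<close>, the
  \<open>g\<close> for which \<open>w\<close> divides all \<open>g p\<^sub>i\<close> form an ideal \<open>(e)\<close> that contains \<open>w\<close>, and the content is
  \<open>c = w / e\<close>. If \<open>a\<close> divides all coefficients of \<open>p / c\<close>, it divides the leading one, which is
  \<open>e = a t\<close>; but then \<open>t\<close> is in \<open>(e)\<close> too, so \<open>a\<close> is a unit.
\<close>

lemma content_primitive_decomposition:
  assumes p: "p \<in> polys_over A" "p \<noteq> 0"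
  obtains c q where "c \<in> A" "c \<noteq> 0" "q \<in> polys_over A" "primitive q" "p = smult c q"
proof -
  define w where "w = lead_coeff p"
  have w: "w \<in> A" "w \<noteq> 0" using p coeff_mem by (auto simp: w_def)
  define U where "U = coeff p ` {..degree p}"
  obtain e where e: "e \<in> A" "\<And>g. g \<in> A \<Longrightarrow> (\<forall>u\<in>U. dvd_in A w (g * u)) \<longleftrightarrow> dvd_in A e g"
  proof -
    have "finite U" "U \<subseteq> A" using coeff_mem[OF p(1)] by (auto simp: U_def)
    from principal_colon_finite[OF this w(1)] show thesis using that by blast
  qed
  have Ucoeff: "(\<forall>u\<in>U. dvd_in A w (g * u)) \<longleftrightarrow> (\<forall>i. dvd_in A w (g * coeff p i))" for g
  proof -
    have "dvd_in A w (g * coeff p i)" if "\<not> i \<le> degree p" for i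
      using that by (simp add: coeff_eq_0 dvd_in_zero)
    then show ?thesis by (auto simp: U_def)
  qed
  have "dvd_in A e w"
    using e(2)[OF w(1)] Ucoeff p(1) coeff_mem dvd_in_triv by blast
  then obtain c where c: "c \<in> A" "w = e * c" by (auto simp: dvd_in_def)
  have nz: "e \<noteq> 0" "c \<noteq> 0" using c w by auto
  have eU: "dvd_in A w (e * coeff p i)" for i
    using e(2)[OF e(1)] Ucoeff dvd_in_refl by blast
  then have "const_dvd c p"
    using dvd_in_mult_cancel_left e c nz coeff_mem[OF p(1)] by (auto simp: const_dvd_def)
  then obtain q where q: "q \<in> polys_over A" "p = smult c q" using const_dvd_iff by blast
  have lq: "coeff q (degree p) = e"
  proof -
    have "c * coeff q (degree p) = c * e" using q c by (simp add: w_def mult.commute)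
    then show ?thesis using mult_left_cancel_mem q(1) coeff_mem c nz e by metis
  qed
  have "primitive q"
    unfolding primitive_def
  proof (intro ballI impI)
    fix a assume a: "a \<in> A" "const_dvd a q"
    then obtain t where t: "t \<in> A" "e = a * t" by (auto simp: const_dvd_def dvd_in_def simp flip: lq)
    have tz: "t \<noteq> 0" using t nz by auto
    have "dvd_in A w (t * coeff p i)" for i
    proof -
      obtain s where s: "s \<in> A" "coeff q i = a * s" using a by (auto simp: const_dvd_def dvd_in_def)
      have "t * coeff p i = w * s" using s q c t by (simp add: ac_simps)
      then show ?thesis using s dvd_in_triv by simp
    qed
    then have "dvd_in A e t" using e(2)[OF t(1)] Ucoeff by blast
    then have "dvd_in A (t * a) (t * 1)" using t by (simp add: mult.commute)
    then show "dvd_in A a 1" using dvd_in_mult_cancel_left t a one_mem tz by blast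
  qed
  then show thesis using that c nz q by blast
qed

text \<open>
  The Euclidean algorithm. For \<open>degree p \<le> degree q\<close>, one step of pseudo-division replaces \<open>q\<close> by
  \<open>r = lc(p) q - lc(q) x\<^sup>k p\<close>, and \<open>r\<close> by its primitive part. Neither changes the set of \<open>g\<close> for which
  \<open>p\<close> divides \<open>g q\<close>, because \<open>p\<close> is primitive and multiplying by nonzero constants has no effect.
  In the other case \<open>p\<close> and \<open>q\<close> are exchanged by \<open>principal_colon_swap\<close>.
\<close>

lemma principal_colon_primitive:
  assumes "p \<in> polys_over A" "primitive p" "p \<noteq> 0" "q \<in> polys_over A" "primitive q" "q \<noteq> 0"
  shows "principal_colon (polys_over A) p q"
  using assms
proof (induction "degree p + degree q" arbitrary: p q rule: less_induct)
  case less
  \<comment> \<open>The reduction step, isolated so that it applies to both orders of the two polynomials.\<close>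
  have main: "principal_colon (polys_over A) p q"
    if IH: "\<And>r. degree r < degree q \<Longrightarrow> r \<in> polys_over A \<Longrightarrow> primitive r \<Longrightarrow> r \<noteq> 0 \<Longrightarrow>
              principal_colon (polys_over A) p r"
      and p: "p \<in> polys_over A" "primitive p" "p \<noteq> 0"
      and q: "q \<in> polys_over A" "primitive q" "q \<noteq> 0"
      and le: "degree p \<le> degree q" for p q
  proof -
    let ?B = "polys_over A"
    define k where "k = degree q - degree p"
    define r where "r = smult (lead_coeff p) q - monom (lead_coeff q) k * p"
    have lc: "lead_coeff p \<in> A" "lead_coeff p \<noteq> 0" using p coeff_mem by auto
    have m: "monom (lead_coeff q) k \<in> ?B" using q by (intro monom_mem coeff_mem)
    have r: "r \<in> ?B" unfolding r_def by (intro P.diff_mem P.mult_mem smult_mem lc(1) m p(1) q(1))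
    have reduce: "dvd_in ?B p (g * q) \<longleftrightarrow> dvd_in ?B p (g * r)" if g: "g \<in> ?B" for g
    proof -
      have gm: "dvd_in ?B p (g * (monom (lead_coeff q) k * p))"
        using g m P.mult_mem by (auto simp: dvd_in_def intro!: bexI[of _ "g * monom (lead_coeff q) k"])
      have eq: "smult (lead_coeff p) (g * q) = g * r + g * (monom (lead_coeff q) k * p)"
        by (simp add: r_def algebra_simps)
      have "dvd_in ?B p (g * q) \<longleftrightarrow> dvd_in ?B p (smult (lead_coeff p) (g * q))"
        using primitive_dvd_smult_iff p lc g q P.mult_mem by blast
      also have "\<dots> \<longleftrightarrow> dvd_in ?B p (g * r)"
        unfolding eq using gm P.dvd_in_add P.dvd_in_diff by fastforce
      finally show ?thesis .
    qed
    show ?thesis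
    proof (cases "r = 0")
      case True
      then show ?thesis
        using P.principal_colon_zero[of p r] reduce p(1) P.zero_mem
        by (auto simp: principal_colon_def)
    next
      case False
      have "degree r < degree q"
      proof -
        have "degree r \<le> degree q"
          unfolding r_def using le
          by (intro degree_diff_le degree_smult_le order.trans[OF degree_mult_le])
            (auto simp: k_def intro: order.trans[OF add_right_mono[OF degree_monom_le]])
        moreover have "coeff r (degree q) = 0"
          using le by (simp add: r_def k_def coeff_monom_mult)
        ultimately show ?thesis using False by (metis le_neq_implies_less leading_coeff_0_iff)
      qed
      obtain c s where s: "c \<in> A" "c \<noteq> 0" "s \<in> ?B" "primitive s" "r = smult c s"
        using content_primitive_decomposition[OF r False] .
      have "degree s \<le> degree r"
      proof (rule le_degree)
        have "lead_coeff s \<noteq> 0" using False s by auto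
        then show "coeff r (degree s) \<noteq> 0"
          using no_zero_divisors[OF s(1) coeff_mem[OF s(3)]] s(2,5) by (metis coeff_smult)
      qed
      then have "principal_colon ?B p s"
        using IH[of s] s(3-5) \<open>degree r < degree q\<close> False by fastforce
      moreover have "dvd_in ?B p (g * q) \<longleftrightarrow> dvd_in ?B p (g * s)" if "g \<in> ?B" for g
        using reduce[OF that] primitive_dvd_smult_iff[OF p(1,2) s(1,2), of "g * s"] s(3,5) that P.mult_mem
        by simp
      ultimately show ?thesis by (auto simp: principal_colon_def)
    qed
  qed
  show ?case
  proof (cases "degree p \<le> degree q")
    case True
    then show ?thesis using main[of q p] less by auto
  next
    case False
    have "principal_colon (polys_over A) q p"
      by (rule main) (use False less in auto)
    then show ?thesis using P.principal_colon_swap less.prems by blast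
  qed
qed

end

text \<open>
  Divisibility splits into the part of the contents and the part of the primitive polynomials. With
  \<open>(a) : (b) = (c)\<close> in \<open>A\<close> for the contents and \<open>(p') : (q') = (e)\<close> for the primitive parts, the
  colon ideal of \<open>a p'\<close> and \<open>b q'\<close> is generated by \<open>c e\<close>.
\<close>

lemma gcd_subring_polys_over:
  assumes "gcd_subring A" shows "gcd_subring (polys_over A)"
proof -
  interpret gcd_subring A by fact
  interpret P: integral_subring "polys_over A"
    by (rule integral_subring_polys_over) unfold_locales
  let ?B = "polys_over A"
  have "principal_colon ?B p q" if pq: "p \<in> ?B" "q \<in> ?B" for p q
  proof (cases "p = 0 \<or> q = 0")
    case True
    then show ?thesis using P.principal_colon_zero pq by blast
  next
    case False
    obtain a p' where p': "a \<in> A" "a \<noteq> 0" "p' \<in> ?B" "primitive p'" "p = smult a p'"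
      using content_primitive_decomposition[of p] pq False by blast
    obtain b q' where q': "b \<in> A" "b \<noteq> 0" "q' \<in> ?B" "primitive q'" "q = smult b q'"
      using content_primitive_decomposition[of q] pq False by blast
    obtain c where c: "c \<in> A" "\<And>g. g \<in> A \<Longrightarrow> dvd_in A a (g * b) \<longleftrightarrow> dvd_in A c g"
      using colon[OF p'(1) q'(1)] by (auto simp: principal_colon_def)
    obtain z where z: "z \<in> A" "c * b = a * z" using c(2)[OF c(1)] dvd_in_refl[of c] unfolding dvd_in_def by blast
    have cz: "c \<noteq> 0"
    proof -
      have "dvd_in A c a" using c(2)[OF p'(1)] q'(1) dvd_in_triv by blast
      then show ?thesis using p'(2) by (auto simp: dvd_in_def)
    qed
    have "principal_colon ?B p' q'"
      using principal_colon_primitive p'(3-5) q'(3-5) False by (metis smult_0_right)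
    then obtain e where e: "e \<in> ?B" "\<And>g. g \<in> ?B \<Longrightarrow> dvd_in ?B p' (g * q') \<longleftrightarrow> dvd_in ?B e g"
      by (auto simp: principal_colon_def)
    have "dvd_in ?B p (g * q) \<longleftrightarrow> dvd_in ?B (smult c e) g" if g: "g \<in> ?B" for g
    proof
      assume "dvd_in ?B p (g * q)"
      then obtain t where t: "t \<in> ?B" "smult b (g * q') = smult a (p' * t)"
        using p' q' by (auto simp: dvd_in_def)
      have "const_dvd a (smult b (g * q'))"
        using t p' P.mult_mem const_dvd_iff by auto
      moreover have "smult b (g * q') = q' * smult b g" by (simp add: mult.commute)
      ultimately have "const_dvd a (smult b g)"
        using gauss_lemma[OF q'(3,4) p'(1), of "smult b g"] smult_mem q'(1) g by auto
      then have "const_dvd c g"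
        using c(2)[OF coeff_mem[OF g]] by (simp add: const_dvd_def mult.commute)
      then obtain k where k: "k \<in> ?B" "g = smult c k" using const_dvd_iff by blast
      have "dvd_in ?B p' (smult b (g * q'))"
        using t p' smult_mem by (auto simp: dvd_in_def intro!: bexI[of _ "smult a t"])
      then have "dvd_in ?B p' (g * q')"
        using primitive_dvd_smult_iff p' q' g P.mult_mem by blast
      then have "dvd_in ?B p' (k * q')"
        using primitive_dvd_smult_iff[OF p'(3,4) c(1) cz, of "k * q'"] k q' P.mult_mem by simp
      then have "dvd_in ?B e k" using e k by blast
      then show "dvd_in ?B (smult c e) g" using k by (auto simp: dvd_in_def)
    next
      assume "dvd_in ?B (smult c e) g"
      then obtain t where t: "t \<in> ?B" "g = smult c (e * t)" by (auto simp: dvd_in_def)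
      have "dvd_in ?B p' ((e * t) * q')"
        using e t P.mult_mem P.dvd_in_triv by blast
      then obtain s where s: "s \<in> ?B" "e * t * q' = p' * s" by (auto simp: dvd_in_def)
      have "g * q = smult (c * b) (e * t * q')" using t q' by (simp add: ac_simps)
      also have "\<dots> = p * smult z s" unfolding z(2) s(2) p'(5) by (simp add: mult.commute[of z])
      finally show "dvd_in ?B p (g * q)"
        using smult_mem[OF z(1) s(1)] by (simp only: P.dvd_in_triv)
    qed
    then show ?thesis using c e smult_mem by (auto simp: principal_colon_def)
  qed
  then show ?thesis by unfold_locales
qed

section \<open>Adjoining an invertible transcendental element\<close>

text \<open>
  For a unit \<open>x\<close> of the ambient ring this is \<open>A[x, 1/x]\<close>: the elements that become polynomials in
  \<open>x\<close> after multiplication by a power of \<open>x\<close>.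
\<close>

definition laurent_extension :: "'a::comm_ring_1 set \<Rightarrow> 'a \<Rightarrow> 'a set"
  where "laurent_extension A x = {b. \<exists>n. \<exists>p\<in>polys_over A. b * x ^ n = poly p x}"

lemma poly_mem_laurent_extension: "p \<in> polys_over A \<Longrightarrow> poly p x \<in> laurent_extension A x"
  unfolding laurent_extension_def by (auto intro!: exI[of _ 0] bexI[of _ p])

text \<open>
  Evaluation at \<open>x\<close> identifies \<open>A[x, 1/x]\<close> with a localisation of the polynomial ring. Up to powers
  of the unit \<open>x\<close> all elements are polynomials, and divisibility of polynomials in the localisation
  is divisibility up to a power of the variable. Hence a generator of a colon ideal of polynomials
  also generates it in the localisation.
\<close>

lemma gcd_subring_laurent_extension:
  fixes x y :: "'a::comm_ring_1"
  assumes "gcd_subring A" and xy: "x * y = 1"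
    and transcendental: "\<And>p. p \<in> polys_over A \<Longrightarrow> poly p x = 0 \<Longrightarrow> p = 0"
  shows "gcd_subring (laurent_extension A x)" "A \<subseteq> laurent_extension A x"
    "x \<in> laurent_extension A x" "y \<in> laurent_extension A x"
proof -
  interpret gcd_subring A by fact
  interpret P: gcd_subring "polys_over A"
    by (rule gcd_subring_polys_over) unfold_locales
  let ?P = "polys_over A" and ?B = "laurent_extension A x"
  have xyn: "x ^ n * y ^ n = 1" for n
    using xy by (simp flip: power_mult_distrib)
  have cancel: "b * x ^ n * y ^ n = b" for b n
    using xyn[of n] by (simp add: mult.assoc)
  have Xm: "monom 1 n \<in> ?P" for n using one_mem zero_mem by (auto simp: polys_over_def)
  have elim: "\<exists>n. \<exists>p\<in>?P. b * x ^ n = poly p x" if "b \<in> ?B" for b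
    using that by (auto simp: laurent_extension_def)
  have intro: "b \<in> ?B" if "b * x ^ n = poly p x" "p \<in> ?P" for b n p
    using that by (auto simp: laurent_extension_def)
  have poly_eq: "p = q" if "p \<in> ?P" "q \<in> ?P" "poly p x = poly q x" for p q
    using transcendental[of "p - q"] that P.diff_mem by auto
  show AB: "A \<subseteq> ?B"
  proof
    fix a assume "a \<in> A"
    then have "[:a:] \<in> ?P" using monom_mem[of a 0] by (simp add: monom_0)
    then show "a \<in> ?B" using poly_mem_laurent_extension[of "[:a:]" A x] by simp
  qed
  show xB: "x \<in> ?B"
    using poly_mem_laurent_extension[OF Xm[of 1], of x] by (simp add: poly_monom)
  show yB: "y \<in> ?B"
    using xy P.one_mem by (intro intro[of _ 1 1]) (auto simp: mult.commute)
  interpret B: integral_subring ?B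
  proof
    show "1 \<in> ?B" using AB one_mem by blast
    fix a b assume "a \<in> ?B" "b \<in> ?B"
    then obtain n m p q where p: "p \<in> ?P" "a * x ^ n = poly p x"
      and q: "q \<in> ?P" "b * x ^ m = poly q x" using elim by metis
    have "(a - b) * x ^ (n + m) = (a * x ^ n) * x ^ m - (b * x ^ m) * x ^ n"
      by (simp add: algebra_simps power_add)
    also have "\<dots> = poly (p * monom 1 m - q * monom 1 n) x"
      by (simp add: p q poly_monom)
    finally show "a - b \<in> ?B"
      by (rule intro) (intro P.diff_mem P.mult_mem p(1) q(1) Xm)
    have prod: "a * b * x ^ (n + m) = poly (p * q) x"
      by (simp add: power_add algebra_simps flip: p(2) q(2))
    then show "a * b \<in> ?B"
      using intro P.mult_mem p(1) q(1) by blast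
    assume "a * b = 0"
    then have "p * q = 0" using prod transcendental P.mult_mem p q by simp
    then have "p = 0 \<or> q = 0" using P.no_zero_divisors p(1) q(1) by blast
    then have "a * x ^ n = 0 \<or> b * x ^ m = 0" using p(2) q(2) by auto
    then show "a = 0 \<or> b = 0" using cancel by (metis mult_zero_left)
  qed
  have unit: "dvd_in ?B (a * x ^ n) (b * x ^ m) \<longleftrightarrow> dvd_in ?B a b" for a b n m
  proof
    assume "dvd_in ?B (a * x ^ n) (b * x ^ m)"
    then obtain t where t: "t \<in> ?B" "b * x ^ m = a * x ^ n * t" by (auto simp: dvd_in_def)
    then have "b = a * (x ^ n * t * y ^ m)" using cancel[of b m] by (simp add: ac_simps)
    then show "dvd_in ?B a b"
      using t xB yB by (auto simp: dvd_in_def intro!: bexI[of _ "x ^ n * t * y ^ m"] B.mult_mem B.power_mem)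
  next
    assume "dvd_in ?B a b"
    then obtain t where t: "t \<in> ?B" "b = a * t" by (auto simp: dvd_in_def)
    then have "b * x ^ m = (a * x ^ n * y ^ n) * (t * x ^ m)"
      unfolding cancel by (simp add: ac_simps)
    then have "b * x ^ m = a * x ^ n * (t * x ^ m * y ^ n)"
      by (simp add: ac_simps)
    then show "dvd_in ?B (a * x ^ n) (b * x ^ m)"
      unfolding dvd_in_def using t xB yB by (intro bexI[of _ "t * x ^ m * y ^ n"] B.mult_mem B.power_mem) auto
  qed
  have dvd_poly: "dvd_in ?B (poly p x) (poly q x) \<longleftrightarrow> (\<exists>k. dvd_in ?P p (monom 1 k * q))"
    if "p \<in> ?P" "q \<in> ?P" for p q
  proof
    assume "dvd_in ?B (poly p x) (poly q x)"
    then obtain t where t: "t \<in> ?B" "poly q x = poly p x * t" by (auto simp: dvd_in_def)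
    then obtain k s where s: "s \<in> ?P" "t * x ^ k = poly s x" using elim by blast
    have "poly (monom 1 k * q) x = poly (p * s) x"
      by (simp add: poly_monom t ac_simps flip: s(2))
    then have "monom 1 k * q = p * s" using poly_eq P.mult_mem Xm that s by blast
    then show "\<exists>k. dvd_in ?P p (monom 1 k * q)" using s by (auto simp: dvd_in_def)
  next
    assume "\<exists>k. dvd_in ?P p (monom 1 k * q)"
    then obtain k s where s: "s \<in> ?P" "monom 1 k * q = p * s" by (auto simp: dvd_in_def)
    have "poly q x * x ^ k = poly p x * x ^ 0 * poly s x"
      using arg_cong[OF s(2), of "\<lambda>r. poly r x"] by (simp add: poly_monom mult.commute)
    then have "dvd_in ?B (poly p x * x ^ 0) (poly q x * x ^ k)"
      using poly_mem_laurent_extension[OF s(1)] by (auto simp: dvd_in_def)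
    then show "dvd_in ?B (poly p x) (poly q x)" unfolding unit .
  qed
  have "principal_colon ?B a b" if ab: "a \<in> ?B" "b \<in> ?B" for a b
  proof -
    obtain n m p q where p: "p \<in> ?P" "a * x ^ n = poly p x"
      and q: "q \<in> ?P" "b * x ^ m = poly q x" using elim ab by metis
    obtain c where c: "c \<in> ?P" "\<And>g. g \<in> ?P \<Longrightarrow> dvd_in ?P p (g * q) \<longleftrightarrow> dvd_in ?P c g"
      using P.colon[OF p(1) q(1)] by (auto simp: principal_colon_def)
    have "dvd_in ?B a (g * b) \<longleftrightarrow> dvd_in ?B (poly c x) g" if "g \<in> ?B" for g
    proof -
      obtain k r where r: "r \<in> ?P" "g * x ^ k = poly r x" using elim \<open>g \<in> ?B\<close> by blast
      have "g * b * x ^ (k + m) = poly (r * q) x"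
        by (simp add: power_add algebra_simps flip: r(2) q(2))
      then have "dvd_in ?B a (g * b) \<longleftrightarrow> dvd_in ?B (poly p x) (poly (r * q) x)"
        using unit[of a n "g * b" "k + m"] p by simp
      also have "\<dots> \<longleftrightarrow> (\<exists>i. dvd_in ?P p (monom 1 i * r * q))"
        using dvd_poly[of p "r * q"] p r q P.mult_mem by (simp add: mult.assoc)
      also have "\<dots> \<longleftrightarrow> (\<exists>i. dvd_in ?P c (monom 1 i * r))"
        using c(2) r Xm P.mult_mem by simp
      also have "\<dots> \<longleftrightarrow> dvd_in ?B (poly c x) (poly r x)"
        using dvd_poly c r by simp
      also have "\<dots> \<longleftrightarrow> dvd_in ?B (poly c x) g"
        using unit[of "poly c x" 0 g k] r by simp
      finally show ?thesis .
    qed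
    then show ?thesis
      using poly_mem_laurent_extension[OF c(1)] by (auto simp: principal_colon_def)
  qed
  then show "gcd_subring ?B" by unfold_locales
qed

section \<open>Group rings of sublattices\<close>

definition supported_on :: "'g set \<Rightarrow> ('g \<Rightarrow>\<^sub>0 'b::zero) set"
  where "supported_on L = {g. Poly_Mapping.keys g \<subseteq> L}"

lemma lookup_eq_0_supported_on:
  "g \<in> supported_on L \<Longrightarrow> v \<notin> L \<Longrightarrow> Poly_Mapping.lookup g v = 0"
  by (auto simp: supported_on_def Poly_Mapping.in_keys_iff)

lemma single_mem_supported_on: "v \<in> L \<Longrightarrow> Poly_Mapping.single v c \<in> supported_on L"
  by (auto simp: supported_on_def)

lemma sum_single_lookup:
  "(\<Sum>v\<in>Poly_Mapping.keys g. Poly_Mapping.single v (Poly_Mapping.lookup g v)) = g"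
  by (rule poly_mapping_eqI)
    (auto simp: Poly_Mapping.lookup_sum Poly_Mapping.lookup_single when_def Poly_Mapping.in_keys_iff)

lemma lookup_mult_single:
  fixes g :: "'g::ab_group_add \<Rightarrow>\<^sub>0 'b::comm_ring_1"
  shows "Poly_Mapping.lookup (g * Poly_Mapping.single w 1) v = Poly_Mapping.lookup g (v - w)"
proof -
  have "g * Poly_Mapping.single w 1 =
      (\<Sum>u\<in>Poly_Mapping.keys g. Poly_Mapping.single (u + w) (Poly_Mapping.lookup g u))"
    by (subst (1) sum_single_lookup[of g, symmetric])
      (simp add: sum_distrib_right Poly_Mapping.mult_single)
  then have "Poly_Mapping.lookup (g * Poly_Mapping.single w 1) v =
      (\<Sum>u\<in>Poly_Mapping.keys g. if u = v - w then Poly_Mapping.lookup g u else 0)"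
    by (simp add: Poly_Mapping.lookup_sum Poly_Mapping.lookup_single when_def eq_diff_eq)
  then show ?thesis by (simp add: Poly_Mapping.in_keys_iff)
qed

lemma single_power:
  "Poly_Mapping.single (w::int ^ 'd) (1::int) ^ k = Poly_Mapping.single (of_nat k *s w) 1"
proof (induction k)
  case (Suc k)
  have "w + of_nat k *s w = of_nat (Suc k) *s w" by (simp add: vec_eq_iff algebra_simps)
  with Suc show ?case by (simp add: Poly_Mapping.mult_single)
qed simp

lemma mult_mem_supported_on:
  fixes g h :: "'g::ab_group_add \<Rightarrow>\<^sub>0 'b::comm_ring_1"
  assumes "\<And>v w. v \<in> L \<Longrightarrow> w \<in> M \<Longrightarrow> v + w \<in> K" "g \<in> supported_on L" "h \<in> supported_on M"
  shows "g * h \<in> supported_on K"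
  using keys_mult[of g h] assms unfolding supported_on_def by blast

lemma sum_mem_supported_on:
  fixes h :: "'i \<Rightarrow> ('g \<Rightarrow>\<^sub>0 'b::comm_ring_1)"
  assumes "\<And>i. i \<in> I \<Longrightarrow> h i \<in> supported_on L"
  shows "sum h I \<in> supported_on L"
proof -
  have "Poly_Mapping.lookup (sum h I) v = 0" if "v \<notin> L" for v
    using that assms by (auto simp: Poly_Mapping.lookup_sum intro!: sum.neutral lookup_eq_0_supported_on)
  then show ?thesis by (auto simp: supported_on_def Poly_Mapping.in_keys_iff)
qed

text \<open>
  The vectors of \<open>N\<int>\<^sup>d\<close> that involve only the coordinates in \<open>I\<close>. They interpolate between \<open>0\<close>
  and \<open>N\<int>\<^sup>d\<close>, so that the group ring can be built up one variable at a time.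
\<close>

definition coordinate_lattice :: "nat \<Rightarrow> 'd set \<Rightarrow> (int ^ 'd) set"
  where "coordinate_lattice N I = {v. \<forall>j. int N dvd v $ j \<and> (j \<notin> I \<longrightarrow> v $ j = 0)}"

lemma gcd_subring_constants: "gcd_subring (supported_on {0} :: ('g::ab_group_add \<Rightarrow>\<^sub>0 int) set)"
proof -
  let ?s = "Poly_Mapping.single (0::'g) :: int \<Rightarrow> _" and ?A = "supported_on {0} :: ('g \<Rightarrow>\<^sub>0 int) set"
  have A: "?A = range ?s"
  proof (intro subset_antisym subsetI)
    fix g :: "'g \<Rightarrow>\<^sub>0 int" assume "g \<in> ?A"
    then have "g = ?s (Poly_Mapping.lookup g 0)"
      by (intro poly_mapping_eqI) (auto simp: Poly_Mapping.lookup_single when_def lookup_eq_0_supported_on)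
    then show "g \<in> range ?s" by blast
  qed (auto intro: single_mem_supported_on)
  have eq: "?s a = ?s b \<longleftrightarrow> a = b" for a b
    by (metis Poly_Mapping.lookup_single_eq)
  have dvd: "dvd_in ?A (?s a) (?s b) \<longleftrightarrow> a dvd b" for a b
    by (simp add: A dvd_in_def Poly_Mapping.mult_single eq dvd_def)
  interpret integral_subring ?A
  proof
    show "1 \<in> ?A" by (auto intro: single_mem_supported_on simp flip: single_one)
    fix a b assume "a \<in> ?A" "b \<in> ?A"
    then obtain m n where a: "a = ?s m" and b: "b = ?s n" by (auto simp: A)
    show "a - b \<in> ?A" by (auto simp: A a b simp flip: Poly_Mapping.single_diff)
    show "a * b \<in> ?A" by (auto simp: A a b Poly_Mapping.mult_single)
    show "a * b = 0 \<Longrightarrow> a = 0 \<or> b = 0"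
      using eq[of "m * n" 0] by (auto simp: a b Poly_Mapping.mult_single)
  qed
  have "principal_colon ?A a b" if ab: "a \<in> ?A" "b \<in> ?A" for a b
  proof (cases "a = 0")
    case True
    then show ?thesis using principal_colon_zero ab by blast
  next
    case False
    obtain m n where a: "a = ?s m" and b: "b = ?s n" using ab by (auto simp: A)
    have "m \<noteq> 0" using False a by auto
    then obtain m' n' where mn: "m = gcd m n * m'" "n = gcd m n * n'" "coprime m' n'"
      by (metis gcd_coprime_exists gcd_eq_0_iff mult.commute)
    have "m dvd k * n \<longleftrightarrow> m' dvd k" for k
    proof -
      have "m dvd k * n \<longleftrightarrow> gcd m n * m' dvd gcd m n * (k * n')"
        using mn(1,2) by (metis mult.left_commute)
      also have "\<dots> \<longleftrightarrow> m' dvd k * n'" using \<open>m \<noteq> 0\<close> by simp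
      finally show ?thesis using mn(3) by (simp add: coprime_dvd_mult_left_iff)
    qed
    then have "\<forall>g\<in>?A. dvd_in ?A a (g * b) \<longleftrightarrow> dvd_in ?A (?s m') g"
      by (auto simp: A a b Poly_Mapping.mult_single dvd[unfolded A])
    then show ?thesis unfolding principal_colon_def by (auto simp: A)
  qed
  then show ?thesis by unfold_locales
qed

text \<open>
  Enlarging \<open>I\<close> by \<open>i\<close> adjoins to the group ring the monomial \<open>x\<close> with exponent \<open>N e\<^sub>i\<close> and its
  inverse. The monomial is transcendental because exponents of \<open>a x\<^sup>k\<close> and \<open>b x\<^sup>l\<close> with \<open>k \<noteq> l\<close> differ
  in the \<open>i\<close>-th coordinate.
\<close>

lemma gcd_subring_coordinate_lattice:
  assumes N: "N \<ge> 1"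
  shows "gcd_subring (supported_on (coordinate_lattice N I) :: ((int ^ 'd) \<Rightarrow>\<^sub>0 int) set)"
  using finite[of I]
proof (induction I)
  case empty
  have "coordinate_lattice N {} = {0 :: int ^ 'd}"
    by (auto simp: coordinate_lattice_def vec_eq_iff)
  then show ?case using gcd_subring_constants by (simp only:)
next
  case (insert i I)
  let ?L = "coordinate_lattice N I :: (int ^ 'd) set"
    and ?L' = "coordinate_lattice N (insert i I) :: (int ^ 'd) set"
  let ?A = "supported_on ?L :: ((int ^ 'd) \<Rightarrow>\<^sub>0 int) set"
    and ?A' = "supported_on ?L' :: ((int ^ 'd) \<Rightarrow>\<^sub>0 int) set"
  define w :: "int ^ 'd" where "w = axis i (int N)"
  define x :: "(int ^ 'd) \<Rightarrow>\<^sub>0 int" where "x = Poly_Mapping.single w 1"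
  define y :: "(int ^ 'd) \<Rightarrow>\<^sub>0 int" where "y = Poly_Mapping.single (- w) 1"
  have xy: "x * y = 1" by (simp add: x_def y_def Poly_Mapping.mult_single)
  have x_pow: "x ^ k = Poly_Mapping.single (of_nat k *s w) 1" for k
    by (simp add: x_def single_power)
  have y_pow: "y ^ k = Poly_Mapping.single (- (of_nat k *s w)) 1" for k
    by (simp add: y_def single_power vec_eq_iff)
  have w_nth: "w $ j = (if j = i then int N else 0)" for j by (simp add: w_def axis_def)
  have lookup_poly: "Poly_Mapping.lookup (poly p x) v =
      (\<Sum>k\<le>degree p. Poly_Mapping.lookup (coeff p k) (v - of_nat k *s w))" for p v
    by (simp add: poly_altdef Poly_Mapping.lookup_sum x_pow lookup_mult_single)
  have transcendental: "p = 0" if p: "p \<in> polys_over ?A" and zero: "poly p x = 0" for p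
  proof (rule poly_eqI, rule poly_mapping_eqI)
    fix k u
    show "Poly_Mapping.lookup (coeff p k) u = Poly_Mapping.lookup (coeff 0 k) u"
    proof (cases "u \<in> ?L \<and> k \<le> degree p")
      case True
      have "Poly_Mapping.lookup (coeff p l) (u + of_nat k *s w - of_nat l *s w) = 0"
        if "l \<noteq> k" for l
      proof (rule lookup_eq_0_supported_on[OF coeff_mem[OF p]])
        have "u $ i = 0" using True insert.hyps by (auto simp: coordinate_lattice_def)
        then have "(u + of_nat k *s w - of_nat l *s w) $ i = (int k - int l) * int N"
          by (simp add: w_nth algebra_simps)
        also have "\<dots> \<noteq> 0" using that N by simp
        finally show "u + of_nat k *s w - of_nat l *s w \<notin> ?L"
          using insert.hyps unfolding coordinate_lattice_def by blast
      qed
      then have "Poly_Mapping.lookup (poly p x) (u + of_nat k *s w) = Poly_Mapping.lookup (coeff p k) u"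
        unfolding lookup_poly using True by (subst sum.remove[of _ k]) (auto intro!: sum.neutral)
      then show ?thesis using zero by simp
    next
      case False
      then show ?thesis
        using lookup_eq_0_supported_on[OF coeff_mem[OF p]] by (auto simp: coeff_eq_0)
    qed
  qed
  note ext = gcd_subring_laurent_extension[OF insert.IH xy transcendental]
  let ?B = "laurent_extension ?A x"
  interpret B: gcd_subring ?B by (rule ext(1))
  have add: "v + v' \<in> ?L'" if "v \<in> ?L'" "v' \<in> ?L'" for v v'
    using that by (auto simp: coordinate_lattice_def)
  have "?B = ?A'"
  proof (intro subset_antisym subsetI)
    fix b assume "b \<in> ?B"
    then obtain n p where p: "p \<in> polys_over ?A" "b * x ^ n = poly p x"
      by (auto simp: laurent_extension_def)
    have mono: "?A \<subseteq> ?A'" by (auto simp: supported_on_def coordinate_lattice_def)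
    have pow: "x ^ k \<in> ?A'" "y ^ k \<in> ?A'" for k
      unfolding x_pow y_pow
      by (rule single_mem_supported_on; simp add: coordinate_lattice_def w_nth)+
    have "b = poly p x * y ^ n"
      using xy by (simp flip: p(2) add: mult.assoc flip: power_mult_distrib)
    moreover have "poly p x \<in> ?A'"
      unfolding poly_altdef using pow mono coeff_mem[OF p(1)]
      by (intro sum_mem_supported_on mult_mem_supported_on[OF add]) auto
    ultimately show "b \<in> ?A'"
      using pow mult_mem_supported_on[OF add] by blast
  next
    fix b assume b: "b \<in> ?A'"
    have "Poly_Mapping.single v (Poly_Mapping.lookup b v) \<in> ?B" if v: "v \<in> Poly_Mapping.keys b" for v
    proof -
      have vL: "v \<in> ?L'" using v b by (auto simp: supported_on_def)
      then obtain k where k: "v $ i = int N * k" by (auto simp: coordinate_lattice_def)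
      define u where "u = v - k *s w"
      have "u \<in> ?L"
        using vL k by (auto simp: coordinate_lattice_def u_def w_nth)
      then have u: "Poly_Mapping.single u c \<in> ?B" for c
        by (intro subsetD[OF ext(2)] single_mem_supported_on)
      have "- (- k *s w) = k *s w" by (simp add: vec_eq_iff)
      then have "Poly_Mapping.single (k *s w) 1 = (if k \<ge> 0 then x ^ nat k else y ^ nat (- k))"
        by (simp add: x_pow y_pow)
      then have "Poly_Mapping.single (k *s w) 1 \<in> ?B"
        using ext(3,4) B.power_mem by simp
      then have "Poly_Mapping.single u (Poly_Mapping.lookup b v) * Poly_Mapping.single (k *s w) 1 \<in> ?B"
        using u B.mult_mem by blast
      then show ?thesis by (simp add: Poly_Mapping.mult_single u_def)
    qed
    then have "(\<Sum>v\<in>Poly_Mapping.keys b. Poly_Mapping.single v (Poly_Mapping.lookup b v)) \<in> ?B"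
      by (rule B.sum_mem)
    then show "b \<in> ?B" by (simp add: sum_single_lookup)
  qed
  then show ?case using ext(1) by simp
qed

section \<open>Contraction to the group ring of a subgroup\<close>

definition part_on :: "'g set \<Rightarrow> ('g \<Rightarrow>\<^sub>0 'b::zero) \<Rightarrow> ('g \<Rightarrow>\<^sub>0 'b)"
  where "part_on L g = Poly_Mapping.mapp (\<lambda>v c. c when v \<in> L) g"

lemma lookup_part_on:
  "Poly_Mapping.lookup (part_on L g) v = (Poly_Mapping.lookup g v when v \<in> L)"
  by (auto simp: part_on_def lookup_mapp when_def Poly_Mapping.in_keys_iff)

lemma part_on_mem: "part_on L g \<in> supported_on L"
  by (auto simp: supported_on_def Poly_Mapping.in_keys_iff lookup_part_on when_def split: if_splits)

text \<open>
  The projection of the group ring onto the group ring of a subgroup \<open>L\<close> is linear over the latter,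
  since translation by elements of \<open>L\<close> preserves both \<open>L\<close> and its complement.
\<close>

lemma part_on_mult:
  fixes g h :: "'g::ab_group_add \<Rightarrow>\<^sub>0 'b::comm_ring_1"
  assumes diff: "\<And>v w. v \<in> L \<Longrightarrow> w \<in> L \<Longrightarrow> v - w \<in> L" and g: "g \<in> supported_on L"
  shows "part_on L (g * h) = g * part_on L h"
proof (rule poly_mapping_eqI)
  fix v
  have zero: "0 \<in> L" if "u \<in> L" for u using diff[OF that that] by simp
  have add: "u + w \<in> L" if "u \<in> L" "w \<in> L" for u w
    using diff[OF that(1) diff[OF zero[OF that(1)] that(2)]] by simp
  have "h - part_on L h \<in> supported_on (- L)"
    by (auto simp: supported_on_def Poly_Mapping.in_keys_iff lookup_part_on Poly_Mapping.lookup_minus)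
  moreover have "u + w \<in> - L" if "u \<in> L" "w \<in> - L" for u w
    using diff[of "u + w" u] that by auto
  ultimately have out: "g * (h - part_on L h) \<in> supported_on (- L)"
    using mult_mem_supported_on g by blast
  have inL: "g * part_on L h \<in> supported_on L"
    using add g part_on_mem by (rule mult_mem_supported_on)
  have "g * h = g * part_on L h + g * (h - part_on L h)" by (simp add: algebra_simps)
  then have "Poly_Mapping.lookup (g * h) v = Poly_Mapping.lookup (g * part_on L h) v
      + Poly_Mapping.lookup (g * (h - part_on L h)) v"
    by (metis Poly_Mapping.lookup_add)
  then show "Poly_Mapping.lookup (part_on L (g * h)) v = Poly_Mapping.lookup (g * part_on L h) v"
    using lookup_eq_0_supported_on[OF out, of v] lookup_eq_0_supported_on[OF inL, of v]
    by (auto simp: lookup_part_on when_def)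
qed

text \<open>
  The expansion of \<open>h\<close> in the basis of monomials \<open>x\<^sup>r\<close>, with \<open>r\<close> running through representatives of
  the cosets of \<open>L\<close> that \<open>h\<close> meets.
\<close>

lemma coset_decomposition:
  fixes h :: "'g::ab_group_add \<Rightarrow>\<^sub>0 'b::comm_ring_1"
  assumes zero: "0 \<in> L" and diff: "\<And>v w. v \<in> L \<Longrightarrow> w \<in> L \<Longrightarrow> v - w \<in> L"
  obtains T where "finite T"
    "h = (\<Sum>r\<in>T. part_on L (h * Poly_Mapping.single (- r) 1) * Poly_Mapping.single r 1)"
proof -
  \<comment> \<open>The chosen representative of the coset of \<open>v\<close>.\<close>
  define \<rho> where "\<rho> v = (SOME u. v - u \<in> L)" for v
  have \<rho>: "v - \<rho> v \<in> L" for v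
  proof -
    have "\<exists>u. v - u \<in> L" using zero by (intro exI[of _ v]) simp
    then show ?thesis unfolding \<rho>_def by (rule someI_ex)
  qed
  have minus: "- v \<in> L" if "v \<in> L" for v using diff[OF zero that] by simp
  have \<rho>_eq: "\<rho> u = \<rho> v" if "u - v \<in> L" for u v
  proof -
    have "u - t \<in> L \<longleftrightarrow> v - t \<in> L" for t
      using diff[of "u - t" "u - v"] diff[of "v - t" "- (u - v)"] that minus[OF that] by auto
    then show ?thesis by (simp add: \<rho>_def)
  qed
  define T where "T = \<rho> ` Poly_Mapping.keys h"
  have "Poly_Mapping.lookup h v = Poly_Mapping.lookup
      (\<Sum>r\<in>T. part_on L (h * Poly_Mapping.single (- r) 1) * Poly_Mapping.single r 1) v" for v
  proof -
    have "v - r \<in> L \<longleftrightarrow> r = \<rho> v" if r: "r \<in> T" for r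
    proof
      obtain u where u: "r = \<rho> u" using r by (auto simp: T_def)
      assume "v - r \<in> L"
      then have "v - u \<in> L"
        using diff[of "v - r" "u - r"] \<rho>[of u] u by simp
      then show "r = \<rho> v" using \<rho>_eq u by metis
    qed (use \<rho> in simp)
    then have "(\<Sum>r\<in>T. Poly_Mapping.lookup h v when v - r \<in> L) =
        (\<Sum>r\<in>T. if r = \<rho> v then Poly_Mapping.lookup h v else 0)"
      by (intro sum.cong) (auto simp: when_def)
    also have "\<dots> = Poly_Mapping.lookup h v"
      by (auto simp: T_def Poly_Mapping.in_keys_iff)
    finally show ?thesis
      by (simp add: Poly_Mapping.lookup_sum lookup_mult_single lookup_part_on)
  qed
  then show thesis by (intro that[of T] poly_mapping_eqI) (simp_all add: T_def)
qed

text \<open>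
  The contraction is a finite intersection of colon ideals \<open>(w) : (u\<^sub>r)\<close>, where \<open>w = f h\<close> is any
  nonzero element of it and \<open>u\<^sub>r\<close> are the coset coordinates of \<open>h\<close>.
\<close>

lemma contraction_generator:
  fixes f :: "'g::ab_group_add \<Rightarrow>\<^sub>0 'b::comm_ring_1"
  assumes zero: "0 \<in> L" and diff: "\<And>v w. v \<in> L \<Longrightarrow> w \<in> L \<Longrightarrow> v - w \<in> L"
    and "integral_subring (UNIV :: ('g \<Rightarrow>\<^sub>0 'b) set)"
    and "gcd_subring (supported_on L :: ('g \<Rightarrow>\<^sub>0 'b) set)"
  shows "\<exists>c\<in>supported_on L. \<forall>g\<in>supported_on L. f dvd g \<longleftrightarrow> dvd_in (supported_on L) c g"
proof -
  interpret R: integral_subring "UNIV :: ('g \<Rightarrow>\<^sub>0 'b) set" by fact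
  let ?S = "supported_on L :: ('g \<Rightarrow>\<^sub>0 'b) set"
  interpret S: gcd_subring ?S by fact
  show ?thesis
  proof (cases "\<exists>w\<in>?S. w \<noteq> 0 \<and> f dvd w")
    case False
    then have "f dvd g \<longleftrightarrow> dvd_in ?S 0 g" if "g \<in> ?S" for g
      using that S.zero_mem by (auto simp: dvd_in_def)
    then show ?thesis using S.zero_mem by blast
  next
    case True
    then obtain w h where w: "w \<in> ?S" "w \<noteq> 0" "w = f * h" by (auto simp: dvd_def)
    then have h: "h \<noteq> 0" by auto
    obtain T where T: "finite T"
      "h = (\<Sum>r\<in>T. part_on L (h * Poly_Mapping.single (- r) 1) * Poly_Mapping.single r 1)"
      using coset_decomposition[OF zero diff] .
    define u where "u r = part_on L (h * Poly_Mapping.single (- r) 1)" for r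
    have hu: "h = (\<Sum>r\<in>T. u r * Poly_Mapping.single r 1)" using T(2) by (simp only: u_def)
    obtain c where c: "c \<in> ?S"
      "\<And>g. g \<in> ?S \<Longrightarrow> (\<forall>r\<in>T. dvd_in ?S w (g * u r)) \<longleftrightarrow> dvd_in ?S c g"
    proof -
      have "u ` T \<subseteq> ?S" by (auto simp: u_def part_on_mem)
      from S.principal_colon_finite[OF finite_imageI[OF T(1)] this w(1)]
      show thesis using that by auto
    qed
    have "f dvd g \<longleftrightarrow> (\<forall>r\<in>T. dvd_in ?S w (g * u r))" if g: "g \<in> ?S" for g
    proof
      assume "f dvd g"
      then obtain t where "g = f * t" by (auto simp: dvd_def)
      then have gh: "g * h = w * t" by (simp add: w ac_simps)
      show "\<forall>r\<in>T. dvd_in ?S w (g * u r)"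
      proof
        fix r
        have "g * u r = part_on L (g * (h * Poly_Mapping.single (- r) 1))"
          by (simp only: u_def part_on_mult[OF diff g])
        also have "\<dots> = part_on L (w * (t * Poly_Mapping.single (- r) 1))"
          by (simp add: gh flip: mult.assoc)
        also have "\<dots> = w * part_on L (t * Poly_Mapping.single (- r) 1)"
          by (rule part_on_mult[OF diff w(1)])
        finally show "dvd_in ?S w (g * u r)" by (simp add: S.dvd_in_triv part_on_mem)
      qed
    next
      assume "\<forall>r\<in>T. dvd_in ?S w (g * u r)"
      then have "\<forall>r\<in>T. w dvd g * u r" by (auto simp: dvd_in_def)
      then have "w dvd (\<Sum>r\<in>T. g * u r * Poly_Mapping.single r 1)"
        using dvd_mult2 by (intro dvd_sum) blast
      also have "\<dots> = g * h" by (subst hu) (simp add: sum_distrib_left mult.assoc)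
      finally obtain s where "g * h = f * h * s" by (auto simp: dvd_def w)
      then have "h * g = h * (f * s)" by (simp add: ac_simps)
      then have "g = f * s" using R.mult_left_cancel_mem[of h g "f * s"] h by simp
      then show "f dvd g" by simp
    qed
    then show ?thesis using c by blast
  qed
qed

theorem proposition6p2:
  fixes f :: "(int ^ 'd) \<Rightarrow>\<^sub>0 int" and N :: nat
  assumes "N \<ge> 1"
  shows "principalideal (PIdl\<^bsub>laurent_ring\<^esub> f \<inter> carrier (laurent_subring N)) (laurent_subring N)"
proof -
  let ?L = "coordinate_lattice N UNIV :: (int ^ 'd) set"
  let ?S = "supported_on ?L :: ((int ^ 'd) \<Rightarrow>\<^sub>0 int) set"
  have "multiples_lattice N = ?L"
  proof (intro subset_antisym subsetI)
    fix v assume "v \<in> ?L"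
    then have "v = int N *s (\<chi> j. v $ j div int N)"
      by (auto simp: vec_eq_iff coordinate_lattice_def)
    then show "v \<in> multiples_lattice N" unfolding multiples_lattice_def by blast
  qed (auto simp: multiples_lattice_def coordinate_lattice_def)
  then have S: "carrier (laurent_subring N) = ?S"
    by (simp add: laurent_subring_def supported_on_def)
  \<comment> \<open>The full Laurent polynomial ring is the instance \<open>N = 1\<close>, hence a domain as well.\<close>
  have "supported_on (coordinate_lattice 1 UNIV) = (UNIV :: ((int ^ 'd) \<Rightarrow>\<^sub>0 int) set)"
    by (auto simp: supported_on_def coordinate_lattice_def)
  then have R: "integral_subring (UNIV :: ((int ^ 'd) \<Rightarrow>\<^sub>0 int) set)"
    using gcd_subring_coordinate_lattice[of 1 "UNIV :: 'd set"] by (simp add: gcd_subring_def)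
  have zero: "0 \<in> ?L" by (simp add: coordinate_lattice_def)
  have diff: "v - w \<in> ?L" if "v \<in> ?L" "w \<in> ?L" for v w
    using that by (simp add: coordinate_lattice_def)
  obtain c where c: "c \<in> ?S" "\<And>g. g \<in> ?S \<Longrightarrow> f dvd g \<longleftrightarrow> dvd_in ?S c g"
    using contraction_generator[OF zero diff R gcd_subring_coordinate_lattice[OF assms], where f = f]
    by blast
  have "PIdl\<^bsub>laurent_ring\<^esub> f = {g. f dvd g}"
    by (auto simp: cgenideal_def ring_of_type_algebra_def dvd_def mult.commute)
  moreover have "PIdl\<^bsub>laurent_subring N\<^esub> c = {g. dvd_in ?S c g}"
    by (auto simp: cgenideal_def S dvd_in_def mult.commute)
      (auto simp: laurent_subring_def ring_of_type_algebra_def mult.commute)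
  moreover have "g \<in> ?S" if "dvd_in ?S c g" for g
    using that c(1) gcd_subring_coordinate_lattice[OF assms, of UNIV]
    by (auto simp: dvd_in_def gcd_subring_def integral_subring_def)
  ultimately have "PIdl\<^bsub>laurent_ring\<^esub> f \<inter> carrier (laurent_subring N) = PIdl\<^bsub>laurent_subring N\<^esub> c"
    using c(2) S by auto
  then show ?thesis
    using cring.cgenideal_is_principalideal[OF cring_laurent_subring] c(1) S by metis
qed

end
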